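(* Let $n\ge 1$, $I=\{1,\ldots,n\}$, $V\in\mathbb{R}_{\ge 0}^{n\times n}$, let $X$ be the permutation matrix of a maximum weight perfect matching for $V$, let $V'=X^TV=(v'_{ij})$ and $u_{ij}=v'_{ij}-v'_{jj}$ for $i,j\in I$. Define $y_j^{(0)}=0$ and $y_j^{(t+1)}=\max_{k\in I}\{y_k^{(t)}+u_{jk}\}$ for $j\in I$, $t\in\mathbb{N}$. Then for each $t=0,\ldots,n-1$ there is a $j_t\in I$ such that $y_{j_t}^{(t)}$ is maximum, i.e. $y_{j_t}^{(t)}=\max_{s=0,\ldots,n-1}y_{j_t}^{(s)}$.
   Context: Maximum weight perfect matching: an $n\times n$ permutation matrix $X$ maximizing $\mathrm{tr}(X^TV)$ over all $n\times n$ permutation matrices. Here $\mathbb{N}$ includes $0$. *)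

theory Defs
  imports "HOL-Analysis.Analysis"
begin

text \<open>The index set \<open>I = {1,...,n}\<close> is rendered as a finite type \<open>'n\<close>, with \<open>n = CARD('n)\<close>.\<close>

definition permutation_matrix :: "real ^ 'n ^ 'n \<Rightarrow> bool" where
  "permutation_matrix X \<longleftrightarrow>
     (\<forall>i j. X $ i $ j \<in> {0, 1}) \<and>
     (\<forall>i. \<exists>!j. X $ i $ j = 1) \<and>
     (\<forall>j. \<exists>!i. X $ i $ j = 1)"

definition max_weight_perfect_matching :: "real ^ 'n ^ 'n \<Rightarrow> real ^ 'n ^ 'n \<Rightarrow> bool" where
  "max_weight_perfect_matching V X \<longleftrightarrow>
     permutation_matrix X \<and>
     (\<forall>Z. permutation_matrix Z \<longrightarrow> trace (transpose Z ** V) \<le> trace (transpose X ** V))"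

definition diag_diff :: "real ^ 'n ^ 'n \<Rightarrow> real ^ 'n ^ 'n" where
  "diag_diff W = (\<chi> i j. W $ i $ j - W $ j $ j)"

text \<open>\<open>max_iter U t j\<close> is the iterate \<open>y\<^sub>j\<close> at step \<open>t\<close> for the matrix \<open>U = (u\<^sub>i\<^sub>j)\<close>.\<close>

primrec max_iter :: "real ^ 'n ^ 'n \<Rightarrow> nat \<Rightarrow> 'n::finite \<Rightarrow> real" where
  "max_iter U 0 = (\<lambda>j. 0)"
| "max_iter U (Suc t) = (\<lambda>j. MAX k\<in>UNIV. max_iter U t k + U $ j $ k)"

end

theory Submission
  imports Defs "HOL-Combinatorics.Cycles"
begin

text \<open>
  Optimality of \<open>X\<close> says that no cycle of the complete digraph on \<open>I\<close> with weights \<open>u\<^sub>i\<^sub>j\<close> has positive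
  weight, so a closed walk, being decomposable into cycles, never has positive weight either. Hence
  ``there is a walk of positive weight from \<open>j\<close> to \<open>k\<close>'' is a strict order on \<open>I\<close>, and by finiteness it has
  a maximal element \<open>j\<close>. No walk from \<open>j\<close> has positive weight; as \<open>y\<^sub>j\<close> at step \<open>t\<close> is the largest weight of a
  walk of length \<open>t\<close> from \<open>j\<close>, and is at least \<open>0\<close> because \<open>u\<^sub>j\<^sub>j = 0\<close>, it vanishes for all \<open>t\<close>. So a single
  \<open>j\<close> serves for every \<open>t\<close>.
\<close>

definition walk_weight :: "('a \<Rightarrow> 'a \<Rightarrow> real) \<Rightarrow> 'a list \<Rightarrow> real" where
  "walk_weight u xs = sum_list (map2 u xs (tl xs))"

lemma walk_weight_simps [simp]:
  "walk_weight u [] = 0"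
  "walk_weight u [x] = 0"
  "walk_weight u (x # y # xs) = u x y + walk_weight u (y # xs)"
  by (simp_all add: walk_weight_def)

lemma walk_weight_append:
  "walk_weight u (xs @ y # ys) = walk_weight u (xs @ [y]) + walk_weight u (y # ys)"
proof (induction xs)
  case (Cons x xs)
  then show ?case by (cases xs) auto
qed simp

text \<open>\<open>cycle_of_list xs\<close> sends each entry to its cyclic successor, so mapping it
  over \<open>xs\<close> gives \<open>rotate1 xs\<close>. This is also the tail of
  \<open>xs @ [hd xs]\<close>, and zipping drops the surplus last vertex of the longer list.\<close>

lemma walk_weight_cycle:
  assumes "distinct xs" "xs \<noteq> []"
  shows "walk_weight u (xs @ [hd xs]) = (\<Sum>x\<in>set xs. u x (cycle_of_list xs x))"
proof -
  have "(\<Sum>x\<in>set xs. u x (cycle_of_list xs x)) = sum_list (map (\<lambda>x. u x (cycle_of_list xs x)) xs)"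
    using assms(1) by (simp add: sum_list_distinct_conv_sum_set)
  also have "\<dots> = sum_list (map2 u xs (map (cycle_of_list xs) xs))"
    by (simp add: map2_map_map [where f = "\<lambda>x. x", simplified])
  also have "\<dots> = sum_list (map2 u xs (rotate1 xs))"
    using cyclic_rotation [OF assms(1), of 1] by simp
  also have "\<dots> = walk_weight u (xs @ [hd xs])"
    using assms(2) zip_append1 [of xs "[hd xs]" "rotate1 xs"]
    by (cases xs) (simp_all add: walk_weight_def)
  finally show ?thesis by simp
qed

text \<open>A repeated vertex \<open>y\<close> splits a closed walk into the loop
  \<open>y # bs\<close> and the walk that skips this loop. Both are closed and shorter, and their
  weights add up, so induction on length reduces to distinct vertices.\<close>

lemma closed_walk_weight_nonpos:
  assumes cycles: "\<And>xs. distinct xs \<Longrightarrow> xs \<noteq> [] \<Longrightarrow> walk_weight u (xs @ [hd xs]) \<le> 0"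
    and "xs \<noteq> []"
  shows "walk_weight u (xs @ [hd xs]) \<le> 0"
  using assms(2)
proof (induction xs rule: length_induct)
  case (1 xs)
  show ?case
  proof (cases "distinct xs")
    case True
    then show ?thesis using cycles 1 by blast
  next
    case False
    then obtain as y bs cs where xs: "xs = as @ [y] @ bs @ [y] @ cs"
      using not_distinct_decomp by blast
    define h where "h = hd xs"
    \<comment> \<open>Skipping the loop keeps one copy of \<open>y\<close>, so the shortened walk
      starts and closes at the same vertex even when \<open>as\<close> is empty.\<close>
    have h: "h = hd (as @ y # cs)"
      unfolding h_def xs by (cases as) auto
    have "walk_weight u (xs @ [h]) =
        walk_weight u (as @ [y]) + walk_weight u (y # bs @ [y]) + walk_weight u (y # cs @ [h])"
      using walk_weight_append [of u as y "bs @ y # cs @ [h]"]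
        walk_weight_append [of u "y # bs" y "cs @ [h]"]
      by (simp add: xs)
    also have "\<dots> = walk_weight u ((as @ y # cs) @ [h]) + walk_weight u ((y # bs) @ [hd (y # bs)])"
      using walk_weight_append [of u as y "cs @ [h]"] by simp
    also have "\<dots> \<le> 0"
    proof -
      have "walk_weight u ((as @ y # cs) @ [hd (as @ y # cs)]) \<le> 0"
        by (rule 1(1) [rule_format]) (simp_all add: xs)
      moreover have "walk_weight u ((y # bs) @ [hd (y # bs)]) \<le> 0"
        by (rule 1(1) [rule_format]) (simp_all add: xs)
      ultimately show ?thesis by (simp add: h)
    qed
    finally show ?thesis by (simp add: h_def)
  qed
qed

lemma exists_source_of_nonpos_walks:
  fixes u :: "'a::finite \<Rightarrow> 'a \<Rightarrow> real"
  assumes closed: "\<And>xs. xs \<noteq> [] \<Longrightarrow> walk_weight u (xs @ [hd xs]) \<le> 0"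
  obtains j where "\<And>ys. walk_weight u (j # ys) \<le> 0"
proof -
  define r where "r = {(j, k). \<exists>xs. walk_weight u (j # xs @ [k]) > 0}"
  have "trans r"
  proof (rule transI)
    fix i j k assume "(i, j) \<in> r" "(j, k) \<in> r"
    then obtain xs ys where "walk_weight u (i # xs @ [j]) > 0" "walk_weight u (j # ys @ [k]) > 0"
      by (auto simp: r_def)
    then have "walk_weight u (i # (xs @ j # ys) @ [k]) > 0"
      using walk_weight_append [of u "i # xs" j "ys @ [k]"] by simp
    then show "(i, k) \<in> r" unfolding r_def by blast
  qed
  moreover have "(j, j) \<notin> r" for j
    using closed [of "j # xs" for xs] by (auto simp: r_def not_less)
  ultimately have "acyclic r" by (simp add: acyclic_def)
  then have "wf (r\<inverse>)" by (simp add: finite_acyclic_wf_converse)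
  \<comment> \<open>A maximal element of \<open>r\<close> is a minimal one of its converse;
    \<open>undefined\<close> merely witnesses that \<open>UNIV\<close> is nonempty.\<close>
  then obtain j where "\<And>k. (k, j) \<in> r\<inverse> \<Longrightarrow> k \<notin> UNIV"
    using wfE_min [of "r\<inverse>" undefined UNIV] by blast
  then have "(j, k) \<notin> r" for k by blast
  then have "walk_weight u (j # ys) \<le> 0" for ys
    \<comment> \<open>An empty \<open>ys\<close> gives weight 0; otherwise the last entry of
      \<open>ys\<close> is the endpoint required by \<open>r\<close>.\<close>
    by (cases ys rule: rev_cases) (auto simp: r_def not_less)
  then show ?thesis using that by blast
qed

text \<open>Following a maximizing index at each step traces out the walk. This turns the bound on
  walks from the source into an upper bound on its iterates.\<close>

lemma max_iter_is_walk_weight: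
  "\<exists>xs. max_iter U t j = walk_weight (\<lambda>i k. U $ i $ k) (j # xs)"
proof (induction t arbitrary: j)
  case 0
  have "max_iter U 0 j = walk_weight (\<lambda>i k. U $ i $ k) [j]" by simp
  then show ?case by blast
next
  case (Suc t)
  have "max_iter U (Suc t) j \<in> range (\<lambda>k. max_iter U t k + U $ j $ k)"
    unfolding max_iter.simps by (rule Max_in) auto
  then obtain k where k: "max_iter U (Suc t) j = max_iter U t k + U $ j $ k" by blast
  obtain xs where "max_iter U t k = walk_weight (\<lambda>i k. U $ i $ k) (k # xs)"
    using Suc.IH by blast
  with k have "max_iter U (Suc t) j = walk_weight (\<lambda>i k. U $ i $ k) (j # k # xs)" by simp
  then show ?case by blast
qed

text \<open>Choosing \<open>k = j\<close> in the maximum, that is, waiting at \<open>j\<close> along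
  its loop of weight 0, shows that the iterates at \<open>j\<close> never decrease.\<close>

lemma max_iter_nonneg:
  assumes "\<And>j. U $ j $ j = 0"
  shows "0 \<le> max_iter U t j"
proof (induction t)
  case (Suc t)
  have "max_iter U t j + U $ j $ j \<le> max_iter U (Suc t) j"
    unfolding max_iter.simps by (rule Max_ge) auto
  with Suc assms show ?case by simp
qed simp

lemma permutation_matrix_permute_columns:
  assumes "permutation_matrix X" "bij f"
  shows "permutation_matrix (\<chi> i j. X $ i $ f j)"
proof -
  have "\<exists>!j. X $ i $ f j = 1" for i
  proof -
    obtain k where "X $ i $ k = 1" "\<And>k'. X $ i $ k' = 1 \<Longrightarrow> k' = k"
      using assms(1) unfolding permutation_matrix_def by metis
    then show ?thesis using assms(2) by (metis bij_pointE)
  qed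
  then show ?thesis
    using assms(1) by (simp add: permutation_matrix_def)
qed

lemma trace_transpose_mult:
  fixes Z V :: "real ^ 'n ^ 'n"
  shows "trace (transpose Z ** V) = (\<Sum>j\<in>UNIV. \<Sum>k\<in>UNIV. Z $ k $ j * V $ k $ j)"
  by (simp add: trace_def matrix_matrix_mult_def transpose_def)

text \<open>Passing to \<open>transpose X ** V\<close> makes the identity an optimal permutation:
  the left side is the weight for \<open>V\<close> of the competing matching obtained by permuting
  the columns of \<open>X\<close>.\<close>

lemma max_weight_perfect_matching_permutes:
  fixes V X :: "real ^ 'n ^ 'n"
  assumes "max_weight_perfect_matching V X" "bij f"
  shows "(\<Sum>i\<in>UNIV. (transpose X ** V) $ i $ f i) \<le> trace (transpose X ** V)"
proof -
  \<comment> \<open>With \<open>inv f\<close>, column \<open>f i\<close> of \<open>Z\<close> is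
    column \<open>i\<close> of \<open>X\<close>, so its product with column \<open>f i\<close> of
    \<open>V\<close> is the entry at \<open>(i, f i)\<close>.\<close>
  define Z where "Z = (\<chi> i j. X $ i $ inv f j)"
  have "(\<Sum>i\<in>UNIV. (transpose X ** V) $ i $ f i)
      = (\<Sum>i\<in>UNIV. \<Sum>k\<in>UNIV. Z $ k $ f i * V $ k $ f i)"
    using assms(2) by (simp add: Z_def matrix_matrix_mult_def transpose_def bij_is_inj)
  also have "\<dots> = trace (transpose Z ** V)"
    unfolding trace_transpose_mult
    by (rule sum.reindex_bij_betw [OF assms(2), of "\<lambda>j. \<Sum>k\<in>UNIV. Z $ k $ j * V $ k $ j"])
  also have "\<dots> \<le> trace (transpose X ** V)"
    using assms permutation_matrix_permute_columns [of X "inv f"] bij_imp_bij_inv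
    by (auto simp: max_weight_perfect_matching_def Z_def)
  finally show ?thesis .
qed

text \<open>The cycle extends to a permutation \<open>f\<close> fixing all other indices, where
  \<open>diag_diff\<close> contributes 0. The subtracted diagonal entries, reindexed along
  \<open>f\<close>, sum to the trace, so the weight compares \<open>f\<close> with the
  identity.\<close>

lemma max_weight_perfect_matching_cycle_weight:
  fixes V X :: "real ^ 'n ^ 'n"
  assumes "max_weight_perfect_matching V X" "distinct xs" "xs \<noteq> []"
  shows "walk_weight (\<lambda>i k. diag_diff (transpose X ** V) $ i $ k) (xs @ [hd xs]) \<le> 0"
proof -
  define W where "W = transpose X ** V"
  define f where "f = cycle_of_list xs"
  have bij: "bij f"
    unfolding f_def by (rule permutation_bijective [OF permutation_of_cycle])
  have "walk_weight (\<lambda>i k. diag_diff W $ i $ k) (xs @ [hd xs]) = (\<Sum>x\<in>set xs. diag_diff W $ x $ f x)"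
    using assms(2,3) by (simp add: walk_weight_cycle f_def)
  also have "\<dots> = (\<Sum>x\<in>UNIV. diag_diff W $ x $ f x)"
    by (rule sum.mono_neutral_left) (auto simp: f_def id_outside_supp diag_diff_def)
  also have "\<dots> = (\<Sum>x\<in>UNIV. W $ x $ f x) - (\<Sum>x\<in>UNIV. W $ f x $ f x)"
    by (simp add: diag_diff_def sum_subtractf)
  also have "(\<Sum>x\<in>UNIV. W $ f x $ f x) = trace W"
    unfolding trace_def by (rule sum.reindex_bij_betw [OF bij, of "\<lambda>x. W $ x $ x"])
  also have "(\<Sum>x\<in>UNIV. W $ x $ f x) - trace W \<le> 0"
    using max_weight_perfect_matching_permutes [OF assms(1) bij] by (simp add: W_def)
  finally show ?thesis by (simp add: W_def)
qed

theorem corollary2p6: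
  fixes V X V' U :: "real ^ 'n ^ 'n" and y :: "nat \<Rightarrow> 'n \<Rightarrow> real"
  assumes "\<And>i j. 0 \<le> V $ i $ j"
    and "max_weight_perfect_matching V X"
    and "V' = transpose X ** V"
    and "U = diag_diff V'"
    and "y = max_iter U"
  shows "\<forall>t \<in> {0..CARD('n) - 1}. \<exists>j. y t j = (MAX s\<in>{0..CARD('n) - 1}. y s j)"
proof -
  have "walk_weight (\<lambda>i k. U $ i $ k) (xs @ [hd xs]) \<le> 0" if "xs \<noteq> []" for xs
    by (rule closed_walk_weight_nonpos [OF _ that])
      (simp add: assms(3,4) max_weight_perfect_matching_cycle_weight [OF assms(2)])
  then obtain j where j: "\<And>ys. walk_weight (\<lambda>i k. U $ i $ k) (j # ys) \<le> 0"
    using exists_source_of_nonpos_walks by blast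
  have "y t j = 0" for t
  proof (rule antisym)
    show "y t j \<le> 0"
      using max_iter_is_walk_weight [of U t j] j by (auto simp: assms(5))
    show "0 \<le> y t j"
      by (simp add: assms(4,5) max_iter_nonneg diag_diff_def)
  qed
  then show ?thesis by (intro ballI exI [of _ j]) simp
qed

end
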